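(* Let $\mathfrak n_{5,3}$ be the Lie algebra over $\mathbb F$ with ordered basis $\{x_1,x_2,x_3,x_4,x_5\}$ whose only nonzero brackets of basis elements (up to skew-symmetry) are $[x_4,x_2]=-x_1$ and $[x_5,x_3]=-x_1$. Then for all $j,k,l,m,n,p,q,r,s,t\in\mathbb Z_{\ge0}$ the following identity holds in $\mathbf U(\mathfrak n_{5,3})$: $$\begin{aligned} &(x_1^jx_2^kx_3^lx_4^mx_5^n)(x_1^px_2^qx_3^rx_4^sx_5^t)\\ &=\sum_{\alpha=0}^{\min\{n,r\}}\ \sum_{\beta=0}^{\min\{m,q\}}\binom{n}{\alpha}\binom{r}{\alpha}\binom{m}{\beta}\binom{q}{\beta}\alpha!\,\beta!\,(-1)^{\alpha+\beta}\, x_1^{j+p+\alpha+\beta}x_2^{k+q-\beta}x_3^{l+r-\alpha} x_4^{m+s-\beta}x_5^{n+t-\alpha}. \end{aligned}$$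
   Context: $\mathbb F$ is $\mathbb R$ or $\mathbb C$. $\mathbf U(L)$ denotes the universal enveloping algebra of the Lie algebra $L$ (the universal unital associative $\mathbb F$-algebra with a linear map $\iota:L\to\mathbf U(L)$ satisfying $\iota([x,y])=\iota(x)\iota(y)-\iota(y)\iota(x)$). Elements of $L$ are identified with their images under $\iota$, so $xy=yx+[x,y]$ in $\mathbf U(L)$ for $x,y\in L$; powers and products of the $x_i$ are taken in $\mathbf U(L)$. *)

theory Defs
  imports "HOL-Library.Poly_Mapping" "HOL-Algebra.Algebraic_Closure_Type"
begin

section \<open>The base field\<close>

text \<open>
  A field that is the field of real numbers or the field of complex numbers, up to field isomorphism.
\<close>

class real_or_complex = field +
  assumes real_or_complex:
    "(\<exists>f :: 'a \<Rightarrow> real. bij f \<and> f 1 = 1 \<and> (\<forall>a b. f (a + b) = f a + f b \<and> f (a * b) = f a * f b)) \<or>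
     (\<exists>f :: 'a \<Rightarrow> complex. bij f \<and> f 1 = 1 \<and> (\<forall>a b. f (a + b) = f a + f b \<and> f (a * b) = f a * f b))"

instance real :: real_or_complex
  by standard (rule disjI1, rule exI[of _ "\<lambda>x. x"], auto simp: bij_def)

instance complex :: real_or_complex
  by standard (rule disjI2, rule exI[of _ "\<lambda>x. x"], auto simp: bij_def)


section \<open>Lie algebras and unital associative algebras\<close>

locale lie_algebra = vector_space scale
  for scale :: "'f::field \<Rightarrow> 'l::ab_group_add \<Rightarrow> 'l" +
  fixes bracket :: "'l \<Rightarrow> 'l \<Rightarrow> 'l"
  assumes bracket_add_left: "bracket (x + y) z = bracket x z + bracket y z"
    and bracket_add_right: "bracket x (y + z) = bracket x y + bracket x z"
    and bracket_scale_left: "bracket (scale c x) y = scale c (bracket x y)"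
    and bracket_scale_right: "bracket x (scale c y) = scale c (bracket x y)"
    and bracket_self: "bracket x x = 0"
    and jacobi: "bracket x (bracket y z) + bracket y (bracket z x) + bracket z (bracket x y) = 0"

text \<open>
  The locale \<^locale>\<open>algebra\<close> of the library is restricted to commutative algebras.
\<close>

locale unital_algebra =
  module ring_of_type_algebra A + ring A
  for A :: "('f::field, 'a, 'm) module_scheme" (structure) +
  assumes smult_mult_left:
      "\<lbrakk>a \<in> carrier A; b \<in> carrier A\<rbrakk> \<Longrightarrow> (c \<odot> a) \<otimes> b = c \<odot> (a \<otimes> b)"
    and smult_mult_right:
      "\<lbrakk>a \<in> carrier A; b \<in> carrier A\<rbrakk> \<Longrightarrow> a \<otimes> (c \<odot> b) = c \<odot> (a \<otimes> b)"


section \<open>The universal enveloping algebra\<close>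

text \<open>
  With concatenation as addition, lists form the free monoid. Hence \<^typ>\<open>'l list \<Rightarrow>\<^sub>0 'f\<close> with the
  convolution product is the free unital associative algebra on the set of all elements of
  \<open>'l\<close>; the scalar \<open>c\<close> is \<open>Poly_Mapping.single [] c\<close>.
\<close>

instantiation list :: (type) monoid_add
begin

definition zero_list_def: "0 = ([] :: 'a list)"
definition plus_list_def: "xs + ys = (xs @ ys :: 'a list)"

instance by standard (simp_all add: zero_list_def plus_list_def)

end

definition free_gen :: "'l \<Rightarrow> ('l list \<Rightarrow>\<^sub>0 'f::field)"
  where "free_gen x = Poly_Mapping.single [x] 1"

text \<open>
  The free algebra on the set \<open>L\<close> modulo the linearity relations is the tensor algebra of
  the vector space \<open>L\<close>; the last set contains the relations \<open>[x, y] = x y - y x\<close>.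
\<close>

definition envelope_relations ::
    "('f::field \<Rightarrow> 'l::ab_group_add \<Rightarrow> 'l) \<Rightarrow> ('l \<Rightarrow> 'l \<Rightarrow> 'l) \<Rightarrow> ('l list \<Rightarrow>\<^sub>0 'f) set"
  where "envelope_relations scale bracket =
    {free_gen (x + y) - (free_gen x + free_gen y) | x y. True} \<union>
    {free_gen (scale c x) - Poly_Mapping.single [] c * free_gen x | c x. True} \<union>
    {free_gen (bracket x y) - (free_gen x * free_gen y - free_gen y * free_gen x) | x y. True}"

definition envelope_ideal ::
    "('f::field \<Rightarrow> 'l::ab_group_add \<Rightarrow> 'l) \<Rightarrow> ('l \<Rightarrow> 'l \<Rightarrow> 'l) \<Rightarrow> ('l list \<Rightarrow>\<^sub>0 'f) set"
  where "envelope_ideal scale bracket =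
    Idl\<^bsub>ring_of_type_algebra\<^esub> (envelope_relations scale bracket)"

definition envelope_class ::
    "('f::field \<Rightarrow> 'l::ab_group_add \<Rightarrow> 'l) \<Rightarrow> ('l \<Rightarrow> 'l \<Rightarrow> 'l) \<Rightarrow> ('l list \<Rightarrow>\<^sub>0 'f) \<Rightarrow> ('l list \<Rightarrow>\<^sub>0 'f) set"
  where "envelope_class scale bracket p =
    envelope_ideal scale bracket +>\<^bsub>ring_of_type_algebra\<^esub> p"

definition universal_envelope ::
    "('f::field \<Rightarrow> 'l::ab_group_add \<Rightarrow> 'l) \<Rightarrow> ('l \<Rightarrow> 'l \<Rightarrow> 'l) \<Rightarrow> ('f, ('l list \<Rightarrow>\<^sub>0 'f) set) module"
  where "universal_envelope scale bracket =
    (let Q = ring_of_type_algebra Quot envelope_ideal scale bracket in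
      \<lparr>carrier = carrier Q, monoid.mult = monoid.mult Q, one = one Q, zero = zero Q, add = add Q,
       module.smult = (\<lambda>c u. envelope_class scale bracket (Poly_Mapping.single [] c) \<otimes>\<^bsub>Q\<^esub> u)\<rparr>)"

definition envelope_map ::
    "('f::field \<Rightarrow> 'l::ab_group_add \<Rightarrow> 'l) \<Rightarrow> ('l \<Rightarrow> 'l \<Rightarrow> 'l) \<Rightarrow> 'l \<Rightarrow> ('l list \<Rightarrow>\<^sub>0 'f) set"
  where "envelope_map scale bracket x = envelope_class scale bracket (free_gen x)"


section \<open>The universal property\<close>

lemma rta_simps:
  "carrier ring_of_type_algebra = UNIV"
  "monoid.mult ring_of_type_algebra = (*)"
  "one ring_of_type_algebra = 1"
  "zero ring_of_type_algebra = 0"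
  "add ring_of_type_algebra = (+)"
  by (auto simp: ring_of_type_algebra_def)

lemma rta_ring: "ring (ring_of_type_algebra :: 'a::ring_1 ring)"
proof (rule ringI)
  show "abelian_group (ring_of_type_algebra :: 'a ring)"
  proof (rule abelian_groupI)
    show "\<And>x. x \<in> carrier (ring_of_type_algebra :: 'a ring) \<Longrightarrow>
      \<exists>y\<in>carrier ring_of_type_algebra. y \<oplus>\<^bsub>ring_of_type_algebra\<^esub> x = \<zero>\<^bsub>ring_of_type_algebra\<^esub>"
      by (auto simp: rta_simps intro: exI[of _ "- _"])
  qed (auto simp: rta_simps algebra_simps)
  show "monoid (ring_of_type_algebra :: 'a ring)"
    by unfold_locales (auto simp: rta_simps algebra_simps)
qed (auto simp: rta_simps algebra_simps)

lemma envelope_ideal: "ideal (envelope_ideal scale bracket) ring_of_type_algebra"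
  unfolding envelope_ideal_def
  by (rule ring.genideal_ideal[OF rta_ring]) (simp add: rta_simps)

lemma envelope_class_eq_iff:
  fixes scale :: "'f::field \<Rightarrow> 'l::ab_group_add \<Rightarrow> 'l"
    and bracket :: "'l \<Rightarrow> 'l \<Rightarrow> 'l"
  shows "envelope_class scale bracket p = envelope_class scale bracket q \<longleftrightarrow>
   p - q \<in> envelope_ideal scale bracket"
proof -
  interpret R: ring "ring_of_type_algebra :: ('l list \<Rightarrow>\<^sub>0 'f) ring"
    by (rule rta_ring)
  interpret I: ideal "envelope_ideal scale bracket" ring_of_type_algebra
    by (rule envelope_ideal)
  have uminus: "\<ominus>\<^bsub>ring_of_type_algebra\<^esub> q = - q" for q :: "'l list \<Rightarrow>\<^sub>0 'f"
    by (rule R.minus_equality) (auto simp: rta_simps)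
  have "a_minus ring_of_type_algebra p q = p - q" 
    unfolding a_minus_def uminus by (simp add: rta_simps)
  then show ?thesis
    using R.quotient_eq_iff_same_a_r_cos[OF envelope_ideal, of p q]
    by (simp add: envelope_class_def rta_simps)
qed

lemma
  fixes scale :: "'f::field \<Rightarrow> 'l::ab_group_add \<Rightarrow> 'l"
    and bracket :: "'l \<Rightarrow> 'l \<Rightarrow> 'l"
  shows carrier_envelope: "carrier (universal_envelope scale bracket) = range (envelope_class scale bracket)"
    and mult_envelope: "envelope_class scale bracket p \<otimes>\<^bsub>universal_envelope scale bracket\<^esub> envelope_class scale bracket q =
      envelope_class scale bracket (p * q)"
    and add_envelope: "envelope_class scale bracket p \<oplus>\<^bsub>universal_envelope scale bracket\<^esub> envelope_class scale bracket q =
      envelope_class scale bracket (p + q)"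
    and one_envelope: "\<one>\<^bsub>universal_envelope scale bracket\<^esub> = envelope_class scale bracket 1"
    and zero_envelope: "\<zero>\<^bsub>universal_envelope scale bracket\<^esub> = envelope_class scale bracket 0"
    and smult_envelope: "c \<odot>\<^bsub>universal_envelope scale bracket\<^esub> envelope_class scale bracket p =
      envelope_class scale bracket (Poly_Mapping.single [] c * p)"
proof -
  interpret R: ring "ring_of_type_algebra :: ('l list \<Rightarrow>\<^sub>0 'f) ring"
    by (rule rta_ring)
  interpret I: ideal "envelope_ideal scale bracket" ring_of_type_algebra
    by (rule envelope_ideal)
  interpret h: ring_hom_ring ring_of_type_algebra
    "ring_of_type_algebra Quot envelope_ideal scale bracket" "envelope_class scale bracket"
    using I.rcos_ring_hom_ring by (simp add: envelope_class_def[abs_def])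
  show "carrier (universal_envelope scale bracket) = range (envelope_class scale bracket)"
    by (auto simp: universal_envelope_def Let_def FactRing_def A_RCOSETS_def' envelope_class_def rta_simps)
  show m: "envelope_class scale bracket p \<otimes>\<^bsub>universal_envelope scale bracket\<^esub> envelope_class scale bracket q =
      envelope_class scale bracket (p * q)" for p q
    using h.hom_mult[of p q] by (simp add: universal_envelope_def Let_def rta_simps)
  show "envelope_class scale bracket p \<oplus>\<^bsub>universal_envelope scale bracket\<^esub> envelope_class scale bracket q =
      envelope_class scale bracket (p + q)"
    using h.hom_add[of p q] by (simp add: universal_envelope_def Let_def rta_simps)
  show "\<one>\<^bsub>universal_envelope scale bracket\<^esub> = envelope_class scale bracket 1"
    using h.hom_one by (simp add: universal_envelope_def Let_def rta_simps)
  show "\<zero>\<^bsub>universal_envelope scale bracket\<^esub> = envelope_class scale bracket 0"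
    using h.hom_zero by (simp add: universal_envelope_def Let_def rta_simps)
  show "c \<odot>\<^bsub>universal_envelope scale bracket\<^esub> envelope_class scale bracket p =
      envelope_class scale bracket (Poly_Mapping.single [] c * p)"
    using m[of "Poly_Mapping.single [] c" p] by (simp add: universal_envelope_def Let_def)
qed

lemmas envelope_simps =
  carrier_envelope mult_envelope add_envelope one_envelope zero_envelope smult_envelope

lemma mult_single_list:
  "Poly_Mapping.single u c * Poly_Mapping.single v d =
   Poly_Mapping.single (u @ v) (c * d :: 'f::field)"
  by (simp add: mult_single plus_list_def)

lemma single_Nil_one: "Poly_Mapping.single [] (1 :: 'f::field) = 1"
  using single_one[where 'a = "'a list"] by (simp add: zero_list_def)

lemma single_induct [case_names single add]:
  fixes p :: "'b \<Rightarrow>\<^sub>0 'f::ab_group_add"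
  assumes "\<And>w c. P (Poly_Mapping.single w c)" "\<And>p q. P p \<Longrightarrow> P q \<Longrightarrow> P (p + q)"
  shows "P p"
proof (induction p rule: update_induct)
  case const
  then show ?case using assms(1)[of _ 0] by simp
next
  case (update f a b)
  have "Poly_Mapping.update a b f = f + Poly_Mapping.single a b"
    using update by (intro poly_mapping_eqI)
      (auto simp: lookup_update lookup_add lookup_single when_def in_keys_iff)
  then show ?case using assms update by simp
qed

lemma single_Nil_central:
  fixes p :: "'l list \<Rightarrow>\<^sub>0 'f::field"
  shows "p * Poly_Mapping.single [] c = Poly_Mapping.single [] c * p"
  by (induction p rule: single_induct) (simp_all add: mult_single_list algebra_simps)

theorem unital_algebra_envelope:
  fixes scale :: "'f::field \<Rightarrow> 'l::ab_group_add \<Rightarrow> 'l"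
    and bracket :: "'l \<Rightarrow> 'l \<Rightarrow> 'l"
  shows "unital_algebra (universal_envelope scale bracket)"
proof -
  let ?U = "universal_envelope scale bracket"
  let ?c = "envelope_class scale bracket"
  have grp: "abelian_group ?U"
  proof (rule abelian_groupI)
    fix x assume "x \<in> carrier ?U"
    then obtain p where "x = ?c p" by (auto simp: envelope_simps)
    then have "?c (- p) \<oplus>\<^bsub>?U\<^esub> x = \<zero>\<^bsub>?U\<^esub>" by (simp add: envelope_simps)
    then show "\<exists>y\<in>carrier ?U. y \<oplus>\<^bsub>?U\<^esub> x = \<zero>\<^bsub>?U\<^esub>"
      by (auto simp: envelope_simps)
  qed (auto simp: envelope_simps algebra_simps)
  have mon: "monoid ?U"
    by unfold_locales (auto simp: envelope_simps algebra_simps)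
  have ring: "ring ?U"
    by (rule ringI[OF grp mon]) (auto simp: envelope_simps algebra_simps)
  have cring: "cring (ring_of_type_algebra :: 'f ring)"
    by (rule cring_from_type_algebra)
  have s: "Poly_Mapping.single [] a * (Poly_Mapping.single [] b * p) =
    Poly_Mapping.single [] (a * b) * p" for a b :: 'f and p :: "'l list \<Rightarrow>\<^sub>0 'f"
    by (simp add: mult_single_list flip: mult.assoc)
  have m: "module (ring_of_type_algebra :: 'f ring) ?U"
    by (rule moduleI[OF cring grp])
      (auto simp: envelope_simps rta_simps s single_add single_Nil_one algebra_simps)
  have "unital_algebra_axioms ?U"
  proof
    fix a b and c :: 'f assume "a \<in> carrier ?U" "b \<in> carrier ?U"
    then obtain p q where "a = ?c p" "b = ?c q" by (auto simp: envelope_simps)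
    moreover have "p * (Poly_Mapping.single [] c * q) = Poly_Mapping.single [] c * (p * q)"
      using single_Nil_central[of p c] by (simp flip: mult.assoc)
    ultimately show "(c \<odot>\<^bsub>?U\<^esub> a) \<otimes>\<^bsub>?U\<^esub> b = c \<odot>\<^bsub>?U\<^esub> (a \<otimes>\<^bsub>?U\<^esub> b)"
      "a \<otimes>\<^bsub>?U\<^esub> (c \<odot>\<^bsub>?U\<^esub> b) = c \<odot>\<^bsub>?U\<^esub> (a \<otimes>\<^bsub>?U\<^esub> b)"
      by (simp_all add: envelope_simps mult.assoc)
  qed
  with m ring show ?thesis by (simp add: unital_algebra_def)
qed

lemma
  fixes scale :: "'f::field \<Rightarrow> 'l::ab_group_add \<Rightarrow> 'l"
    and bracket :: "'l \<Rightarrow> 'l \<Rightarrow> 'l"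
  defines "U \<equiv> universal_envelope scale bracket"
    and "\<iota> \<equiv> envelope_map scale bracket"
  shows envelope_map_closed: "\<iota> x \<in> carrier U"
    and envelope_map_add: "\<iota> (x + y) = \<iota> x \<oplus>\<^bsub>U\<^esub> \<iota> y"
    and envelope_map_scale: "\<iota> (scale c x) = c \<odot>\<^bsub>U\<^esub> \<iota> x"
    and envelope_map_bracket: "\<iota> (bracket x y) = \<iota> x \<otimes>\<^bsub>U\<^esub> \<iota> y \<ominus>\<^bsub>U\<^esub> \<iota> y \<otimes>\<^bsub>U\<^esub> \<iota> x"
proof -
  let ?c = "envelope_class scale bracket"
  interpret U: unital_algebra U unfolding U_def by (rule unital_algebra_envelope)
  have rel: "?c p = ?c q" if "p - q \<in> envelope_relations scale bracket" for p q
    using that ring.genideal_self[OF rta_ring, of "envelope_relations scale bracket"]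
    by (auto simp: envelope_class_eq_iff envelope_ideal_def rta_simps)
  show "\<iota> x \<in> carrier U" by (auto simp: U_def \<iota>_def envelope_map_def envelope_simps)
  have "?c (free_gen (x + y)) = ?c (free_gen x + free_gen y)"
    by (rule rel) (auto simp: envelope_relations_def)
  then show "\<iota> (x + y) = \<iota> x \<oplus>\<^bsub>U\<^esub> \<iota> y" by (simp add: U_def \<iota>_def envelope_map_def envelope_simps)
  have "?c (free_gen (scale c x)) = ?c (Poly_Mapping.single [] c * free_gen x)"
    by (rule rel) (auto simp: envelope_relations_def)
  then show "\<iota> (scale c x) = c \<odot>\<^bsub>U\<^esub> \<iota> x" by (simp add: U_def \<iota>_def envelope_map_def envelope_simps)
  have "?c (free_gen (bracket x y)) = ?c (free_gen x * free_gen y - free_gen y * free_gen x)"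
    by (rule rel) (auto simp: envelope_relations_def)
  moreover have "\<ominus>\<^bsub>U\<^esub> ?c p = ?c (- p)" for p
    by (rule U.minus_equality) (auto simp: U_def envelope_simps)
  ultimately show "\<iota> (bracket x y) = \<iota> x \<otimes>\<^bsub>U\<^esub> \<iota> y \<ominus>\<^bsub>U\<^esub> \<iota> y \<otimes>\<^bsub>U\<^esub> \<iota> x"
    by (simp add: a_minus_def) (simp add: U_def \<iota>_def envelope_map_def envelope_simps)
qed

definition word_eval :: "('f::field, 'a, 'm) module_scheme \<Rightarrow> ('l \<Rightarrow> 'a) \<Rightarrow> 'l list \<Rightarrow> 'a"
  where "word_eval A g w = foldr (\<lambda>x a. g x \<otimes>\<^bsub>A\<^esub> a) w \<one>\<^bsub>A\<^esub>"

definition free_eval :: "('f::field, 'a, 'm) module_scheme \<Rightarrow> ('l \<Rightarrow> 'a) \<Rightarrow> ('l list \<Rightarrow>\<^sub>0 'f) \<Rightarrow> 'a"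
  where "free_eval A g p =
    (\<Oplus>\<^bsub>A\<^esub>w\<in>Poly_Mapping.keys p. Poly_Mapping.lookup p w \<odot>\<^bsub>A\<^esub> word_eval A g w)"

context unital_algebra
begin

lemma sm_closed: "x \<in> carrier A \<Longrightarrow> c \<odot> x \<in> carrier A"
  using smult_closed[of c x] by (simp add: rta_simps)

lemma sm_l: "x \<in> carrier A \<Longrightarrow> (a + b) \<odot> x = a \<odot> x \<oplus> b \<odot> x"
  using smult_l_distr[of a b x] by (simp add: rta_simps)

lemma sm_assoc: "x \<in> carrier A \<Longrightarrow> (a * b) \<odot> x = a \<odot> (b \<odot> x)"
  using smult_assoc1[of a b x] by (simp add: rta_simps)

lemma sm_swap: "x \<in> carrier A \<Longrightarrow> a \<odot> (b \<odot> x) = b \<odot> (a \<odot> x)"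
  by (metis mult.commute sm_assoc)

lemma sm_one: "x \<in> carrier A \<Longrightarrow> 1 \<odot> x = x"
  using smult_one[of x] by (simp add: rta_simps)

lemma sm_zero: "x \<in> carrier A \<Longrightarrow> 0 \<odot> x = \<zero>"
  using smult_l_null[of x] by (simp add: rta_simps)

context
  fixes g :: "'l \<Rightarrow> 'a"
  assumes g: "g x \<in> carrier A"
begin

lemma word_eval_closed: "word_eval A g w \<in> carrier A"
  by (induction w) (auto simp: word_eval_def g)

lemma word_eval_append: "word_eval A g (u @ v) = word_eval A g u \<otimes> word_eval A g v"
proof (induction u)
  case Nil
  show ?case using word_eval_closed[of v] by (simp add: word_eval_def)
next
  case (Cons x u)
  have "word_eval A g (x # u) = g x \<otimes> word_eval A g u" for u by (simp add: word_eval_def)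
  with Cons show ?case by (simp add: m_assoc g word_eval_closed)
qed

lemma free_eval_superset:
  assumes "finite S" "Poly_Mapping.keys p \<subseteq> S"
  shows "free_eval A g p = (\<Oplus>w\<in>S. Poly_Mapping.lookup p w \<odot> word_eval A g w)"
  unfolding free_eval_def using assms
  by (intro add.finprod_mono_neutral_cong_left)
    (auto simp: sm_zero sm_closed word_eval_closed in_keys_iff)

lemma free_eval_closed: "free_eval A g p \<in> carrier A"
  unfolding free_eval_def by (intro finsum_closed) (auto simp: sm_closed word_eval_closed)

lemma free_eval_add: "free_eval A g (p + q) = free_eval A g p \<oplus> free_eval A g q"
proof -
  let ?S = "Poly_Mapping.keys p \<union> Poly_Mapping.keys q"
  have "free_eval A g (p + q) = (\<Oplus>w\<in>?S. Poly_Mapping.lookup p w \<odot> word_eval A g w \<oplus>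
      Poly_Mapping.lookup q w \<odot> word_eval A g w)"
    by (subst free_eval_superset[of ?S])
      (auto simp: lookup_add sm_l word_eval_closed dest: subsetD[OF Poly_Mapping.keys_add])
  also have "\<dots> = free_eval A g p \<oplus> free_eval A g q"
    by (subst finsum_addf)
      (auto simp: sm_closed word_eval_closed free_eval_superset[of ?S])
  finally show ?thesis .
qed

lemma free_eval_single: "free_eval A g (Poly_Mapping.single w c) = c \<odot> word_eval A g w"
  by (subst free_eval_superset[of "{w}"]) (auto simp: sm_closed word_eval_closed)

lemma free_eval_mult: "free_eval A g (p * q) = free_eval A g p \<otimes> free_eval A g q"
proof (induction p rule: single_induct)
  case (single u c)
  show ?case
    by (induction q rule: single_induct)
      (simp_all add: mult_single_list free_eval_single word_eval_append smult_mult_left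
        smult_mult_right sm_closed word_eval_closed sm_assoc sm_swap free_eval_add distrib_left
        r_distr free_eval_closed)
qed (simp add: distrib_right free_eval_add l_distr free_eval_closed)

lemma free_eval_one: "free_eval A g 1 = \<one>"
  using free_eval_single[of "[]" 1] by (simp add: single_Nil_one word_eval_def sm_one)

lemma free_eval_gen: "free_eval A g (free_gen x) = g x"
  by (simp add: free_gen_def free_eval_single word_eval_def sm_one g)

lemma free_eval_scalar:
  "x \<in> carrier A \<Longrightarrow> free_eval A g (Poly_Mapping.single [] c) \<otimes> x = c \<odot> x"
  by (simp add: free_eval_single smult_mult_left word_eval_def)

lemma free_eval_diff: "free_eval A g (p - q) = free_eval A g p \<ominus> free_eval A g q"
proof -
  have "free_eval A g (p - q) \<oplus> free_eval A g q = free_eval A g p"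
    by (simp flip: free_eval_add)
  then show ?thesis
    by (metis a_minus_def add.inv_solve_right free_eval_closed)
qed

lemma free_eval_zero: "free_eval A g 0 = \<zero>"
  by (simp add: free_eval_def)

end

end

theorem envelope_universal:
  fixes scale :: "'f::field \<Rightarrow> 'l::ab_group_add \<Rightarrow> 'l"
    and bracket :: "'l \<Rightarrow> 'l \<Rightarrow> 'l"
    and A :: "('f, 'a, 'm) module_scheme"
    and g :: "'l \<Rightarrow> 'a"
  defines "U \<equiv> universal_envelope scale bracket"
    and "\<iota> \<equiv> envelope_map scale bracket"
  assumes "unital_algebra A"
    and g: "\<And>x. g x \<in> carrier A"
    and g_add: "\<And>x y. g (x + y) = g x \<oplus>\<^bsub>A\<^esub> g y"
    and g_scale: "\<And>c x. g (scale c x) = c \<odot>\<^bsub>A\<^esub> g x"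
    and g_bracket: "\<And>x y. g (bracket x y) = g x \<otimes>\<^bsub>A\<^esub> g y \<ominus>\<^bsub>A\<^esub> g y \<otimes>\<^bsub>A\<^esub> g x"
  shows "\<exists>!\<phi>. \<phi> \<in> extensional (carrier U) \<and> \<phi> \<in> ring_hom U A \<and>
    (\<forall>c. \<forall>u\<in>carrier U. \<phi> (c \<odot>\<^bsub>U\<^esub> u) = c \<odot>\<^bsub>A\<^esub> \<phi> u) \<and> (\<forall>x. \<phi> (\<iota> x) = g x)"
    (is "\<exists>!\<phi>. ?P \<phi>")
proof -
  interpret A: unital_algebra A by fact
  let ?c = "envelope_class scale bracket"
  let ?F = "free_eval A g"
  note [simp] = A.free_eval_closed[OF g]
  note ev = A.free_eval_add[OF g] A.free_eval_mult[OF g] A.free_eval_one[OF g]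
    A.free_eval_gen[OF g] A.free_eval_scalar[OF g] A.free_eval_diff[OF g] A.free_eval_zero[OF g]
  have minus_self: "a \<ominus>\<^bsub>A\<^esub> a = \<zero>\<^bsub>A\<^esub>" if "a \<in> carrier A" for a
    using that by (simp add: a_minus_def A.r_neg)
  have ring_A: "ring A" by (rule unital_algebra.axioms(2)) fact
  have "?F \<in> ring_hom ring_of_type_algebra A"
    by (rule ring_hom_memI) (simp_all add: rta_simps ev)
  then have hom: "ring_hom_ring ring_of_type_algebra A ?F"
    by (rule ring_hom_ringI2[OF rta_ring ring_A])
  have "envelope_ideal scale bracket \<subseteq> a_kernel ring_of_type_algebra A ?F"
    unfolding envelope_ideal_def
  proof (rule ring.genideal_minimal[OF rta_ring ring_hom_ring.kernel_is_ideal[OF hom]])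
    show "envelope_relations scale bracket \<subseteq> a_kernel ring_of_type_algebra A ?F"
      by (auto simp: envelope_relations_def a_kernel_def' rta_simps ev g_add g_scale g_bracket
          minus_self g A.sm_closed)
  qed
  then have ker: "?F p = \<zero>\<^bsub>A\<^esub>" if "p \<in> envelope_ideal scale bracket" for p
    using that by (auto simp: a_kernel_def')
  have wd: "?F p = ?F q" if "?c p = ?c q" for p q
  proof -
    have "?F p \<ominus>\<^bsub>A\<^esub> ?F q = \<zero>\<^bsub>A\<^esub>"
      using ker[of "p - q"] that by (simp add: envelope_class_eq_iff ev)
    then show ?thesis by simp
  qed
  define \<phi> where "\<phi> = (\<lambda>u\<in>carrier U. ?F (SOME p. u = ?c p))"
  have \<phi>: "\<phi> (?c p) = ?F p" for p
  proof -
    have "?c p = ?c (SOME q. ?c p = ?c q)" by (rule someI[of _ p]) simp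
    from wd[OF this] show ?thesis by (auto simp: \<phi>_def U_def envelope_simps)
  qed
  have "?P \<phi>"
  proof (intro conjI)
    show "\<phi> \<in> ring_hom U A"
      by (rule ring_hom_memI) (auto simp: U_def envelope_simps \<phi> ev)
  qed (auto simp: U_def \<iota>_def envelope_simps \<phi> ev envelope_map_def, auto simp: \<phi>_def U_def envelope_simps)
  moreover have "\<psi> = \<phi>" if "?P \<psi>" for \<psi>
  proof -
    have hom: "\<psi> \<in> ring_hom U A" and sc: "\<And>c p. \<psi> (?c (Poly_Mapping.single [] c * p)) = c \<odot>\<^bsub>A\<^esub> \<psi> (?c p)"
      and gen: "\<And>x. \<psi> (?c (free_gen x)) = g x" and ext: "\<psi> \<in> extensional (carrier U)"
      using that by (auto simp: U_def \<iota>_def envelope_simps envelope_map_def)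
    have \<psi>: "\<psi> (?c (p * q)) = \<psi> (?c p) \<otimes>\<^bsub>A\<^esub> \<psi> (?c q)" "\<psi> (?c (p + q)) = \<psi> (?c p) \<oplus>\<^bsub>A\<^esub> \<psi> (?c q)"
      "\<psi> (?c 1) = \<one>\<^bsub>A\<^esub>" for p q
      using ring_hom_mult[OF hom, of "?c p" "?c q"] ring_hom_add[OF hom, of "?c p" "?c q"]
        ring_hom_one[OF hom] by (simp_all add: U_def envelope_simps)
    have word: "\<psi> (?c (Poly_Mapping.single w 1)) = word_eval A g w" for w
    proof (induction w)
      case Nil
      show ?case by (simp add: single_Nil_one \<psi> word_eval_def)
    next
      case (Cons x w)
      have "Poly_Mapping.single (x # w) (1::'f) = free_gen x * Poly_Mapping.single w 1"
        by (simp add: free_gen_def mult_single_list)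
      then show ?case using Cons by (simp add: \<psi> gen word_eval_def)
    qed
    have "\<psi> (?c p) = ?F p" for p
    proof (induction p rule: single_induct)
      case (single w c)
      show ?case
        using sc[of c "Poly_Mapping.single w 1"]
        by (simp add: mult_single_list word A.free_eval_single[OF g])
    qed (simp add: \<psi> ev)
    then have "\<psi> u = \<phi> u" if "u \<in> carrier U" for u
      using that by (auto simp: U_def envelope_simps \<phi>)
    then show ?thesis
      using ext by (intro extensionalityI[of _ "carrier U"]) (auto simp: \<phi>_def)
  qed
  ultimately show ?thesis by (rule ex1I)
qed

end

theory Submission
  imports Defs
begin

text \<open>
  The algebra \<open>n\<^sub>5\<^sub>,\<^sub>3\<close> is two Heisenberg triples, \<open>(x\<^sub>4, x\<^sub>2, x\<^sub>1)\<close> and \<open>(x\<^sub>5, x\<^sub>3, x\<^sub>1)\<close>, sharing the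
  central element \<open>x\<^sub>1\<close> and otherwise commuting with each other. So the only obstacles to sorting the
  product of two ordered monomials are the factors \<open>x\<^sub>4\<^sup>m x\<^sub>2\<^sup>q\<close> and \<open>x\<^sub>5\<^sup>n x\<^sub>3\<^sup>r\<close>, which can be
  brought next to each other and treated independently; this is why the answer is a double sum with
  product coefficients.

  Within one triple the situation is that of the Weyl algebra: if \<open>a b = b a + c z\<close> with \<open>z\<close>
  commuting with \<open>a\<close> and \<open>b\<close>, then the commutator with \<open>a\<close> acts on powers of \<open>b\<close> as \<open>c z\<close> times the
  derivative (lemma \<open>straighten_left\<close>). Iterating this gives the normal ordering formula for
  \<open>a\<^sup>m b\<^sup>q\<close> (lemma \<open>straighten_powers\<close>), in which the coefficient of \<open>c\<^sup>\<beta> z\<^sup>\<beta> b\<^bsup>q-\<beta>\<^esup> a\<^bsup>m-\<beta>\<^esup>\<close> counts the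
  ways to match \<open>\<beta>\<close> of the \<open>m\<close> letters \<open>a\<close> with \<open>\<beta>\<close> of the \<open>q\<close> letters \<open>b\<close>. The theorem is the case
  \<open>c = -1\<close>, \<open>z = x\<^sub>1\<close>, used once for each triple.

  All this takes place in an arbitrary unital algebra with elements satisfying the commutation
  relations; the enveloping algebra enters only through the fact that it satisfies them.
\<close>

context unital_algebra
begin

lemma commuting_powers:
  fixes i j :: nat
  assumes "a \<in> carrier A" "b \<in> carrier A" "a \<otimes> b = b \<otimes> a"
  shows "a [^] i \<otimes> b [^] j = b [^] j \<otimes> a [^] i"
  using assms by (metis group_commutes_pow nat_pow_closed)

text \<open>
  The Leibniz rule for the derivation \<open>u \<mapsto> a u - u a\<close>, which maps \<open>b\<close> to \<open>c z\<close>. For \<open>q = 0\<close> the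
  exponent \<open>q - 1\<close> is truncated, which is harmless because the coefficient is zero.
\<close>

lemma straighten_left:
  assumes [simp]: "a \<in> carrier A" "b \<in> carrier A" "z \<in> carrier A"
    and ab: "a \<otimes> b = b \<otimes> a \<oplus> c \<odot> z" and zb: "z \<otimes> b = b \<otimes> z"
  shows "a \<otimes> b [^] q = b [^] q \<otimes> a \<oplus> (of_nat q * c) \<odot> (z \<otimes> b [^] (q - 1))"
proof (induction q)
  case 0
  show ?case by (simp add: sm_zero)
next
  case (Suc q)
  note [simp] = sm_closed
  have zbq: "b [^] i \<otimes> z = z \<otimes> b [^] i" for i :: nat
    using commuting_powers[of b z i 1] zb by simp
  have last: "(of_nat q * c) \<odot> (z \<otimes> b [^] (q - 1)) \<otimes> b = (of_nat q * c) \<odot> (z \<otimes> b [^] q)"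
    by (cases q) (simp_all add: smult_mult_left m_assoc sm_zero)
  have "a \<otimes> b [^] Suc q = (a \<otimes> b [^] q) \<otimes> b"
    by (simp add: m_assoc)
  also have "\<dots> = b [^] q \<otimes> (a \<otimes> b) \<oplus> (of_nat q * c) \<odot> (z \<otimes> b [^] q)"
    using last by (simp add: Suc.IH l_distr m_assoc)
  also have "\<dots> = b [^] Suc q \<otimes> a \<oplus> (c \<odot> (z \<otimes> b [^] q) \<oplus> (of_nat q * c) \<odot> (z \<otimes> b [^] q))"
    by (simp add: ab r_distr smult_mult_right zbq m_assoc a_assoc)
  also have "\<dots> = b [^] Suc q \<otimes> a \<oplus> (of_nat (Suc q) * c) \<odot> (z \<otimes> b [^] (Suc q - 1))"
    by (simp add: distrib_right flip: sm_l)
  finally show ?case .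
qed

text \<open>
  Induction on \<open>m\<close>. Moving the innermost \<open>a\<close> of \<open>a\<^bsup>m+1\<^esup> b\<^sup>q\<close> through \<open>b\<^sup>q\<close> either leaves \<open>a\<^sup>m b\<^sup>q\<close> with the
  new \<open>a\<close> on the far right, or consumes one of the \<open>q\<close> letters \<open>b\<close> and leaves \<open>q c z a\<^sup>m b\<^bsup>q-1\<^esup>\<close>.
  The two contributions to the term with index \<open>\<beta> + 1\<close> add up by Pascal's rule in \<open>m\<close>.
\<close>

lemma straighten_powers:
  assumes [simp]: "a \<in> carrier A" "b \<in> carrier A" "z \<in> carrier A"
    and ab: "a \<otimes> b = b \<otimes> a \<oplus> c \<odot> z"
    and za: "z \<otimes> a = a \<otimes> z" and zb: "z \<otimes> b = b \<otimes> z"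
  shows "a [^] m \<otimes> b [^] q =
    (\<Oplus>\<beta>\<in>{0..min m q}. (of_nat ((m choose \<beta>) * (q choose \<beta>) * fact \<beta>) * c ^ \<beta>) \<odot>
       (z [^] \<beta> \<otimes> b [^] (q - \<beta>) \<otimes> a [^] (m - \<beta>)))"
proof -
  note [simp] = sm_closed
  define C where "C m q \<beta> = (of_nat ((m choose \<beta>) * (q choose \<beta>) * fact \<beta>) * c ^ \<beta> :: 'f)"
    for m q \<beta> :: nat
  define T where "T m q \<beta> = z [^] \<beta> \<otimes> b [^] (q - \<beta>) \<otimes> a [^] (m - \<beta>)" for m q \<beta> :: nat
  have [simp]: "T m q \<beta> \<in> carrier A" for m q \<beta> by (simp add: T_def)
  have C_Suc: "C (Suc m) q (Suc \<beta>) = C m q (Suc \<beta>) + of_nat q * c * C m (q - 1) \<beta>" for m q \<beta>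
  proof (cases q)
    case 0
    then show ?thesis by (simp add: C_def)
  next
    case (Suc q')
    have absorb: "(Suc q' choose Suc \<beta>) * fact (Suc \<beta>) = Suc q' * (q' choose \<beta>) * (fact \<beta> :: nat)"
      using Suc_times_binomial_eq[of q' \<beta>] by (metis fact_Suc mult.assoc mult.commute of_nat_id)
    have "(Suc m choose Suc \<beta>) * (Suc q' choose Suc \<beta>) * fact (Suc \<beta>) =
        (m choose Suc \<beta>) * (Suc q' choose Suc \<beta>) * fact (Suc \<beta>) +
        (m choose \<beta>) * ((Suc q' choose Suc \<beta>) * (fact (Suc \<beta>) :: nat))"
      by (simp only: binomial_Suc_Suc[of m \<beta>] distrib_right mult.assoc add.commute)
    also have "(m choose \<beta>) * ((Suc q' choose Suc \<beta>) * (fact (Suc \<beta>) :: nat)) =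
        Suc q' * ((m choose \<beta>) * (q' choose \<beta>) * fact \<beta>)"
      unfolding absorb by (simp only: mult_ac)
    finally have "(Suc m choose Suc \<beta>) * (Suc q' choose Suc \<beta>) * fact (Suc \<beta>) =
        (m choose Suc \<beta>) * (Suc q' choose Suc \<beta>) * fact (Suc \<beta>) +
        Suc q' * ((m choose \<beta>) * (q' choose \<beta>) * (fact \<beta> :: nat))" .
    then show ?thesis
      unfolding C_def Suc by (simp only: of_nat_add of_nat_mult) (simp add: algebra_simps)
  qed
  \<comment> \<open>Summing up to \<open>m\<close> instead of \<open>min m q\<close> keeps the range the same for \<open>q\<close> and \<open>q - 1\<close> in the
    induction; the binomial coefficient \<open>q choose \<beta>\<close> kills the additional terms.\<close>
  have "a [^] m \<otimes> b [^] q = (\<Oplus>\<beta>\<in>{..m}. C m q \<beta> \<odot> T m q \<beta>)"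
  proof (induction m arbitrary: q)
    case 0
    show ?case by (simp add: C_def T_def sm_one)
  next
    case (Suc m)
    have T_a: "T m q \<beta> \<otimes> a = T (Suc m) q \<beta>" if "\<beta> \<le> m" for \<beta>
      using that by (simp add: T_def m_assoc Suc_diff_le)
    have am_z: "a [^] m \<otimes> z = z \<otimes> a [^] m"
      using commuting_powers[of a z m 1] za by simp
    have z_T: "z \<otimes> T m (q - 1) \<beta> = T (Suc m) q (Suc \<beta>)" for \<beta>
      using commuting_powers[of z z 1 \<beta>] by (simp add: T_def flip: m_assoc)
    have "a [^] Suc m \<otimes> b [^] q = a [^] m \<otimes> (a \<otimes> b [^] q)"
      by (simp add: m_assoc)
    also have "\<dots> = (a [^] m \<otimes> b [^] q) \<otimes> a \<oplus>
        (of_nat q * c) \<odot> (z \<otimes> (a [^] m \<otimes> b [^] (q - 1)))"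
      using am_z by (simp add: straighten_left[OF assms(1-4) zb] r_distr smult_mult_right flip: m_assoc)
    also have "(a [^] m \<otimes> b [^] q) \<otimes> a = (\<Oplus>\<beta>\<in>{..m}. C m q \<beta> \<odot> T (Suc m) q \<beta>)"
      by (simp add: Suc.IH finsum_ldistr smult_mult_left T_a cong: finsum_cong)
    also have "(\<Oplus>\<beta>\<in>{..m}. C m q \<beta> \<odot> T (Suc m) q \<beta>) = (\<Oplus>\<beta>\<in>{..Suc m}. C m q \<beta> \<odot> T (Suc m) q \<beta>)"
      by (simp add: C_def sm_zero binomial_eq_0)
    also have "\<dots> = (\<Oplus>\<beta>\<in>{..m}. C m q (Suc \<beta>) \<odot> T (Suc m) q (Suc \<beta>)) \<oplus> C m q 0 \<odot> T (Suc m) q 0"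
      by (subst finsum_Suc2) auto
    also have "(of_nat q * c) \<odot> (z \<otimes> (a [^] m \<otimes> b [^] (q - 1))) =
        (\<Oplus>\<beta>\<in>{..m}. (of_nat q * c * C m (q - 1) \<beta>) \<odot> T (Suc m) q (Suc \<beta>))"
    proof -
      have "(of_nat q * c) \<odot> (z \<otimes> (a [^] m \<otimes> b [^] (q - 1))) =
          ((of_nat q * c) \<odot> z) \<otimes> (\<Oplus>\<beta>\<in>{..m}. C m (q - 1) \<beta> \<odot> T m (q - 1) \<beta>)"
        by (simp add: Suc.IH smult_mult_left)
      also have "\<dots> = (\<Oplus>\<beta>\<in>{..m}. ((of_nat q * c) \<odot> z) \<otimes> (C m (q - 1) \<beta> \<odot> T m (q - 1) \<beta>))"
        by (rule finsum_rdistr) auto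
      also have "\<dots> = (\<Oplus>\<beta>\<in>{..m}. (of_nat q * c * C m (q - 1) \<beta>) \<odot> T (Suc m) q (Suc \<beta>))"
        by (intro finsum_cong') (auto simp: smult_mult_left smult_mult_right z_T[simplified] mult_ac
            simp flip: sm_assoc)
      finally show ?thesis .
    qed
    also have "(\<Oplus>\<beta>\<in>{..m}. C m q (Suc \<beta>) \<odot> T (Suc m) q (Suc \<beta>)) \<oplus> C m q 0 \<odot> T (Suc m) q 0 \<oplus>
        (\<Oplus>\<beta>\<in>{..m}. (of_nat q * c * C m (q - 1) \<beta>) \<odot> T (Suc m) q (Suc \<beta>)) =
        (\<Oplus>\<beta>\<in>{..m}. C (Suc m) q (Suc \<beta>) \<odot> T (Suc m) q (Suc \<beta>)) \<oplus> C m q 0 \<odot> T (Suc m) q 0"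
      by (simp add: C_Suc sm_l finsum_addf a_ac)
    also have "C m q 0 = C (Suc m) q 0" by (simp add: C_def)
    also have "(\<Oplus>\<beta>\<in>{..m}. C (Suc m) q (Suc \<beta>) \<odot> T (Suc m) q (Suc \<beta>)) \<oplus> C (Suc m) q 0 \<odot> T (Suc m) q 0 =
        (\<Oplus>\<beta>\<in>{..Suc m}. C (Suc m) q \<beta> \<odot> T (Suc m) q \<beta>)"
      by (subst finsum_Suc2) auto
    finally show ?case .
  qed
  also have "\<dots> = (\<Oplus>\<beta>\<in>{0..min m q}. C m q \<beta> \<odot> T m q \<beta>)"
    by (rule add.finprod_mono_neutral_cong_right) (auto simp: C_def sm_zero binomial_eq_0)
  finally show ?thesis by (simp add: C_def T_def)
qed

text \<open>
  After sorting everything that commutes, what remains is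
  \<open>y\<^sub>1\<^bsup>j+p\<^esup> y\<^sub>2\<^sup>k y\<^sub>3\<^sup>l (y\<^sub>4\<^sup>m y\<^sub>2\<^sup>q) (y\<^sub>5\<^sup>n y\<^sub>3\<^sup>r) y\<^sub>4\<^sup>s y\<^sub>5\<^sup>t\<close>. Each bracket is expanded by
  \<open>straighten_powers\<close>; every summand can then be sorted without producing further terms, since the
  letters \<open>y\<^sub>2, y\<^sub>4\<close> and the letters \<open>y\<^sub>3, y\<^sub>5\<close> already occur in the right order among themselves.
\<close>

lemma n53_monomial_product:
  fixes y :: "nat \<Rightarrow> 'a" and j k l m n p q r s t :: nat
  assumes y [simp]: "\<And>i. y i \<in> carrier A"
    and y42: "y 4 \<otimes> y 2 = y 2 \<otimes> y 4 \<oplus> (- 1) \<odot> y 1"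
    and y53: "y 5 \<otimes> y 3 = y 3 \<otimes> y 5 \<oplus> (- 1) \<odot> y 1"
    and comm: "\<And>a b. \<lbrakk>a \<in> {1..5}; b \<in> {1..5}; {a, b} \<noteq> {2, 4}; {a, b} \<noteq> {3, 5}\<rbrakk> \<Longrightarrow>
           y a \<otimes> y b = y b \<otimes> y a"
  shows "(y 1 [^] j \<otimes> y 2 [^] k \<otimes> y 3 [^] l \<otimes> y 4 [^] m \<otimes> y 5 [^] n) \<otimes>
         (y 1 [^] p \<otimes> y 2 [^] q \<otimes> y 3 [^] r \<otimes> y 4 [^] s \<otimes> y 5 [^] t) =
         (\<Oplus>\<alpha>\<in>{0..min n r}. \<Oplus>\<beta>\<in>{0..min m q}.
            (of_nat ((n choose \<alpha>) * (r choose \<alpha>) * (m choose \<beta>) * (q choose \<beta>) * fact \<alpha> * fact \<beta>)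
               * (- 1) ^ (\<alpha> + \<beta>)) \<odot>
            (y 1 [^] (j + p + \<alpha> + \<beta>) \<otimes> y 2 [^] (k + q - \<beta>) \<otimes> y 3 [^] (l + r - \<alpha>) \<otimes>
             y 4 [^] (m + s - \<beta>) \<otimes> y 5 [^] (n + t - \<alpha>)))"
proof -
  note [simp] = sm_closed and [simp del] = One_nat_def
  have swap: "y a [^] i \<otimes> y b [^] i' = y b [^] i' \<otimes> y a [^] i"
    if "(a, b) \<in> {(2,1), (3,1), (4,1), (5,1), (3,2), (5,2), (4,3), (5,4)}" for a b i i' :: nat
    using that by (intro commuting_powers comm) (auto simp: doubleton_eq_iff)
  have swap_left: "y a [^] i \<otimes> (y b [^] i' \<otimes> u) = y b [^] i' \<otimes> (y a [^] i \<otimes> u)"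
    if "(a, b) \<in> {(2,1), (3,1), (4,1), (5,1), (3,2), (5,2), (4,3), (5,4)}" "u \<in> carrier A"
    for a b i i' :: nat and u
    using swap[OF that(1)] that(2) by (simp flip: m_assoc)
  have merge_left: "y a [^] i \<otimes> (y a [^] i' \<otimes> u) = y a [^] (i + i') \<otimes> u"
    if "u \<in> carrier A" for a i i' :: nat and u
    using that by (simp flip: m_assoc nat_pow_mult)
  \<comment> \<open>Instantiating the indices orients the rules: with variable indices the simplifier would see
    permutative equations and apply them only along its own term order.\<close>
  note swaps = swap[of 2 1] swap[of 3 1] swap[of 4 1] swap[of 5 1]
    swap[of 3 2] swap[of 5 2] swap[of 4 3] swap[of 5 4]
  note swaps_left = swap_left[of 2 1] swap_left[of 3 1] swap_left[of 4 1] swap_left[of 5 1]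
    swap_left[of 3 2] swap_left[of 5 2] swap_left[of 4 3] swap_left[of 5 4]
  note sort = m_assoc swaps swaps_left merge_left nat_pow_mult
  have y1: "y 1 \<otimes> y i = y i \<otimes> y 1" if "i \<in> {1..5}" for i
    using that by (intro comm) (auto simp: doubleton_eq_iff)
  define c :: "nat \<Rightarrow> nat \<Rightarrow> nat \<Rightarrow> 'f"
    where "c m q \<beta> = of_nat ((m choose \<beta>) * (q choose \<beta>) * fact \<beta>) * (- 1) ^ \<beta>" for m q \<beta>
  define F where "F \<beta> = y 1 [^] \<beta> \<otimes> y 2 [^] (q - \<beta>) \<otimes> y 4 [^] (m - \<beta>)" for \<beta>
  define G where "G \<alpha> = y 1 [^] \<alpha> \<otimes> y 3 [^] (r - \<alpha>) \<otimes> y 5 [^] (n - \<alpha>)" for \<alpha>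
  define L where "L = y 1 [^] (j + p) \<otimes> y 2 [^] k \<otimes> y 3 [^] l"
  define R where "R = y 4 [^] s \<otimes> y 5 [^] t"
  have [simp]: "F \<beta> \<in> carrier A" "G \<alpha> \<in> carrier A" "L \<in> carrier A" "R \<in> carrier A" for \<alpha> \<beta>
    by (simp_all add: F_def G_def L_def R_def)
  have f: "y 4 [^] m \<otimes> y 2 [^] q = (\<Oplus>\<beta>\<in>{0..min m q}. c m q \<beta> \<odot> F \<beta>)"
    unfolding c_def F_def by (rule straighten_powers) (simp_all add: y42 y1)
  have g: "y 5 [^] n \<otimes> y 3 [^] r = (\<Oplus>\<alpha>\<in>{0..min n r}. c n r \<alpha> \<odot> G \<alpha>)"
    unfolding c_def G_def by (rule straighten_powers) (simp_all add: y53 y1)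
  have "(y 1 [^] j \<otimes> y 2 [^] k \<otimes> y 3 [^] l \<otimes> y 4 [^] m \<otimes> y 5 [^] n) \<otimes>
         (y 1 [^] p \<otimes> y 2 [^] q \<otimes> y 3 [^] r \<otimes> y 4 [^] s \<otimes> y 5 [^] t) =
        (L \<otimes> (y 4 [^] m \<otimes> y 2 [^] q)) \<otimes> (y 5 [^] n \<otimes> y 3 [^] r) \<otimes> R"
    by (simp add: L_def R_def sort)
  also have "\<dots> = (\<Oplus>\<alpha>\<in>{0..min n r}. \<Oplus>\<beta>\<in>{0..min m q}.
      (L \<otimes> (c m q \<beta> \<odot> F \<beta>)) \<otimes> (c n r \<alpha> \<odot> G \<alpha>) \<otimes> R)"
    unfolding f g by (simp add: finsum_ldistr finsum_rdistr)
  also have "\<dots> = (\<Oplus>\<alpha>\<in>{0..min n r}. \<Oplus>\<beta>\<in>{0..min m q}.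
            (of_nat ((n choose \<alpha>) * (r choose \<alpha>) * (m choose \<beta>) * (q choose \<beta>) * fact \<alpha> * fact \<beta>)
               * (- 1) ^ (\<alpha> + \<beta>)) \<odot>
            (y 1 [^] (j + p + \<alpha> + \<beta>) \<otimes> y 2 [^] (k + q - \<beta>) \<otimes> y 3 [^] (l + r - \<alpha>) \<otimes>
             y 4 [^] (m + s - \<beta>) \<otimes> y 5 [^] (n + t - \<alpha>)))"
  proof (intro finsum_cong' refl)
    fix \<alpha> \<beta> assume \<alpha>: "\<alpha> \<in> {0..min n r}" and \<beta>: "\<beta> \<in> {0..min m q}"
    have "L \<otimes> F \<beta> \<otimes> G \<alpha> \<otimes> R =
        y 1 [^] (j + p + \<alpha> + \<beta>) \<otimes> y 2 [^] (k + q - \<beta>) \<otimes> y 3 [^] (l + r - \<alpha>) \<otimes>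
        y 4 [^] (m + s - \<beta>) \<otimes> y 5 [^] (n + t - \<alpha>)"
      using \<alpha> \<beta> by (simp add: L_def R_def F_def G_def sort add_ac)
    moreover have "c m q \<beta> * c n r \<alpha> =
        of_nat ((n choose \<alpha>) * (r choose \<alpha>) * (m choose \<beta>) * (q choose \<beta>) * fact \<alpha> * fact \<beta>)
          * (- 1) ^ (\<alpha> + \<beta>)"
      by (simp add: c_def power_add mult_ac)
    ultimately show "(L \<otimes> (c m q \<beta> \<odot> F \<beta>)) \<otimes> (c n r \<alpha> \<odot> G \<alpha>) \<otimes> R =
        (of_nat ((n choose \<alpha>) * (r choose \<alpha>) * (m choose \<beta>) * (q choose \<beta>) * fact \<alpha> * fact \<beta>)
               * (- 1) ^ (\<alpha> + \<beta>)) \<odot>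
            (y 1 [^] (j + p + \<alpha> + \<beta>) \<otimes> y 2 [^] (k + q - \<beta>) \<otimes> y 3 [^] (l + r - \<alpha>) \<otimes>
             y 4 [^] (m + s - \<beta>) \<otimes> y 5 [^] (n + t - \<alpha>))"
      by (simp add: smult_mult_left smult_mult_right sm_swap flip: sm_assoc)
  qed auto
  finally show ?thesis .
qed

lemma eq_add_of_minus_eq:
  assumes "u \<in> carrier A" "v \<in> carrier A" "u \<ominus> v = w"
  shows "u = v \<oplus> w"
  using assms by (metis a_minus_def add.inv_closed add.m_comm add.m_closed r_neg2 a_assoc)

end

theorem theorem4p8:
  fixes scale :: "'f::real_or_complex \<Rightarrow> 'l::ab_group_add \<Rightarrow> 'l"
    and bracket :: "'l \<Rightarrow> 'l \<Rightarrow> 'l"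
    and x :: "nat \<Rightarrow> 'l"
    and U :: "('f, ('l list \<Rightarrow>\<^sub>0 'f) set) module" (structure)
    and y :: "nat \<Rightarrow> ('l list \<Rightarrow>\<^sub>0 'f) set"
    and j k l m n p q r s t :: nat
  assumes "lie_algebra scale bracket"
    and "inj_on x {1..5}"
    and "\<not> module.dependent scale (x ` {1..5})"
    and "module.span scale (x ` {1..5}) = UNIV"
    and "bracket (x 4) (x 2) = - x 1"
    and "bracket (x 5) (x 3) = - x 1"
    and "\<And>a b. \<lbrakk>a \<in> {1..5}; b \<in> {1..5}; {a, b} \<noteq> {2, 4}; {a, b} \<noteq> {3, 5}\<rbrakk> \<Longrightarrow>
           bracket (x a) (x b) = 0"
    and "U = universal_envelope scale bracket"
    and "y = (\<lambda>i. envelope_map scale bracket (x i))"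
  shows "(y 1 [^] j \<otimes> y 2 [^] k \<otimes> y 3 [^] l \<otimes> y 4 [^] m \<otimes> y 5 [^] n) \<otimes>
         (y 1 [^] p \<otimes> y 2 [^] q \<otimes> y 3 [^] r \<otimes> y 4 [^] s \<otimes> y 5 [^] t) =
         (\<Oplus>\<alpha>\<in>{0..min n r}. \<Oplus>\<beta>\<in>{0..min m q}.
            (of_nat ((n choose \<alpha>) * (r choose \<alpha>) * (m choose \<beta>) * (q choose \<beta>) * fact \<alpha> * fact \<beta>)
               * (- 1) ^ (\<alpha> + \<beta>)) \<odot>
            (y 1 [^] (j + p + \<alpha> + \<beta>) \<otimes> y 2 [^] (k + q - \<beta>) \<otimes> y 3 [^] (l + r - \<alpha>) \<otimes>
             y 4 [^] (m + s - \<beta>) \<otimes> y 5 [^] (n + t - \<alpha>)))"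
proof -
  interpret lie: lie_algebra scale bracket by fact
  interpret unital_algebra U
    unfolding \<open>U = universal_envelope scale bracket\<close> by (rule unital_algebra_envelope)
  let ?\<iota> = "envelope_map scale bracket"
  have \<iota>: "?\<iota> u \<in> carrier U" "?\<iota> (scale c u) = c \<odot> ?\<iota> u"
    "?\<iota> (bracket u v) = ?\<iota> u \<otimes> ?\<iota> v \<ominus> ?\<iota> v \<otimes> ?\<iota> u" for c u v
    unfolding \<open>U = universal_envelope scale bracket\<close>
    by (rule envelope_map_closed envelope_map_scale envelope_map_bracket)+
  have bracket_y: "y a \<otimes> y b = y b \<otimes> y a \<oplus> ?\<iota> (bracket (x a) (x b))" for a b
    unfolding \<iota>(3) \<open>y = _\<close> by (rule eq_add_of_minus_eq) (auto simp: \<iota>(1))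
  have neg: "?\<iota> (- x 1) = (- 1) \<odot> y 1"
    using \<iota>(2)[of "- 1" "x 1"] by (simp add: \<open>y = _\<close>)
  have zero: "?\<iota> 0 = \<zero>"
    using \<iota>(2)[of 0 0] by (simp add: sm_zero \<iota>(1))
  show ?thesis
  proof (rule n53_monomial_product)
    show y: "y i \<in> carrier U" for i
      by (simp add: \<open>y = _\<close> \<iota>(1))
    show "y 4 \<otimes> y 2 = y 2 \<otimes> y 4 \<oplus> (- 1) \<odot> y 1" "y 5 \<otimes> y 3 = y 3 \<otimes> y 5 \<oplus> (- 1) \<odot> y 1"
      by (simp_all add: bracket_y[of 4 2] bracket_y[of 5 3] assms(5,6) neg del: One_nat_def)
    show "y a \<otimes> y b = y b \<otimes> y a"
      if "a \<in> {1..5}" "b \<in> {1..5}" "{a, b} \<noteq> {2, 4}" "{a, b} \<noteq> {3, 5}" for a b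
      using bracket_y[of a b] y[of a] y[of b] assms(7)[OF that] by (simp add: zero)
  qed
qed

end
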